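(* Let $H=\langle a,b \mid [a,[a,b]],[b,[a,b]]\rangle$ be the discrete Heisenberg group. Then $H$ has infinite depth with respect to its two-element generating set $\{a,b\}$; that is, the depths of elements of $H$ with respect to $\{a,b\}$ are unbounded.
   Context: $[x,y]=x^{-1}y^{-1}xy$. For an infinite group $G$ with finite generating set $A$, $d_A$ denotes the word metric, and the depth of $g\in G$ with respect to $A$ is the $d_A$-distance from $g$ to the complement in $G$ of the closed ball of radius $d_A(1,g)$ about the identity. The depth of $G$ with respect to $A$ is the supremum of the depths of its elements. *)

theory Defs
  imports "HOL-Algebra.Generated_Groups" "HOL-Algebra.Elementary_Groups"
    "HOL-Library.Extended_Nat"
begin

section \<open>Group presentations\<close>

text \<open>
  A letter is a pair: \<open>(x, True)\<close> stands for the generator \<open>x\<close> and \<open>(x, False)\<close> for its formal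
  inverse.  The free group on the type \<open>'a\<close> consists of the words modulo insertion and deletion
  of cancelling pairs of letters.
\<close>

type_synonym 'a word = "('a \<times> bool) list"

inductive cancels :: "'a word \<Rightarrow> 'a word \<Rightarrow> bool" where
  "cancels (u @ (x, e) # (x, \<not> e) # v) (u @ v)"

definition word_eq :: "('a word \<times> 'a word) set" where
  "word_eq = {(u, v). equivclp cancels u v}"

definition free_group :: "'a word set monoid" where
  "free_group = \<lparr>carrier = UNIV // word_eq,
     mult = (\<lambda>X Y. \<Union>u\<in>X. \<Union>v\<in>Y. word_eq `` {u @ v}),
     one = word_eq `` {[]}\<rparr>"

definition free_gen :: "'a \<Rightarrow> 'a word set" where
  "free_gen x = word_eq `` {[(x, True)]}"

definition normal_closure :: "('a, 'b) monoid_scheme \<Rightarrow> 'a set \<Rightarrow> 'a set" where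
  "normal_closure G R = \<Inter> {N. N \<lhd> G \<and> R \<subseteq> N}"

definition presented_group :: "'a word set set \<Rightarrow> 'a word set set monoid" where
  "presented_group R = free_group Mod normal_closure free_group R"

definition presented_gen :: "'a word set set \<Rightarrow> 'a \<Rightarrow> 'a word set set" where
  "presented_gen R x = normal_closure free_group R #>\<^bsub>free_group\<^esub> free_gen x"

section \<open>The discrete Heisenberg group\<close>

definition commutator :: "('a, 'b) monoid_scheme \<Rightarrow> 'a \<Rightarrow> 'a \<Rightarrow> 'a" where
  "commutator G x y = inv\<^bsub>G\<^esub> x \<otimes>\<^bsub>G\<^esub> inv\<^bsub>G\<^esub> y \<otimes>\<^bsub>G\<^esub> x \<otimes>\<^bsub>G\<^esub> y"

datatype heis_letter = Letter_a | Letter_b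

definition heis_relators :: "heis_letter word set set" where
  "heis_relators =
     (let a = free_gen Letter_a; b = free_gen Letter_b; c = commutator free_group a b
      in {commutator free_group a c, commutator free_group b c})"

definition heisenberg :: "heis_letter word set set monoid" where
  "heisenberg = presented_group heis_relators"

definition heis_a :: "heis_letter word set set" where
  "heis_a = presented_gen heis_relators Letter_a"

definition heis_b :: "heis_letter word set set" where
  "heis_b = presented_gen heis_relators Letter_b"

section \<open>Word metric and depth\<close>

text \<open>
  Lengths, distances and depths are extended naturals, so that an infimum over the empty set is
  \<open>\<infinity>\<close>.  For an infinite group with a finite generating set neither elements outside the subgroup
  generated by \<open>A\<close> nor empty complements of balls occur, so all these quantities are finite, apart
  from possibly the final supremum; see \<open>element_depth_finite\<close> below.
\<close>

definition word_length :: "('a, 'b) monoid_scheme \<Rightarrow> 'a set \<Rightarrow> 'a \<Rightarrow> enat" where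
  "word_length G A g =
     (INF ws \<in> {ws. set ws \<subseteq> A \<union> m_inv G ` A \<and> foldr (mult G) ws \<one>\<^bsub>G\<^esub> = g}. enat (length ws))"

definition word_dist :: "('a, 'b) monoid_scheme \<Rightarrow> 'a set \<Rightarrow> 'a \<Rightarrow> 'a \<Rightarrow> enat" where
  "word_dist G A g h = word_length G A (inv\<^bsub>G\<^esub> g \<otimes>\<^bsub>G\<^esub> h)"

definition word_cball :: "('a, 'b) monoid_scheme \<Rightarrow> 'a set \<Rightarrow> enat \<Rightarrow> 'a set" where
  "word_cball G A r = {h \<in> carrier G. word_dist G A \<one>\<^bsub>G\<^esub> h \<le> r}"

definition element_depth :: "('a, 'b) monoid_scheme \<Rightarrow> 'a set \<Rightarrow> 'a \<Rightarrow> enat" where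
  "element_depth G A g =
     (INF h \<in> carrier G - word_cball G A (word_dist G A \<one>\<^bsub>G\<^esub> g). word_dist G A g h)"

definition group_depth :: "('a, 'b) monoid_scheme \<Rightarrow> 'a set \<Rightarrow> enat" where
  "group_depth G A = (SUP g \<in> carrier G. element_depth G A g)"

section \<open>Basic facts\<close>

subsection \<open>Free groups\<close>

lemma equiv_word_eq: "equiv UNIV word_eq"
  unfolding word_eq_def
  by (auto intro!: equivI refl_onI symI transI intro: equivclp_sym equivclp_trans)

lemma cancels_append: "cancels u u' \<Longrightarrow> cancels (p @ u @ q) (p @ u' @ q)"
proof (induction rule: cancels.induct)
  case (1 u x e v)
  show ?case using cancels.intros[of "p @ u" x e "v @ q"] by simp
qed

lemma word_eq_append1: "(u, u') \<in> word_eq \<Longrightarrow> (p @ u @ q, p @ u' @ q) \<in> word_eq"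
  unfolding word_eq_def mem_Collect_eq prod.case
proof (induction rule: equivclp_induct)
  case base
  show ?case by simp
next
  case (step y z)
  have "equivclp cancels (p @ y @ q) (p @ z @ q)"
    using step(2) cancels_append[of y z p q] cancels_append[of z y p q]
    by (auto intro: r_into_equivclp equivclp_sym)
  with step(3) show ?case by (rule equivclp_trans)
qed

lemma word_eq_append:
  assumes "(u, u') \<in> word_eq" "(v, v') \<in> word_eq"
  shows "(u @ v, u' @ v') \<in> word_eq"
  using word_eq_append1[OF assms(1), of "[]" v] word_eq_append1[OF assms(2), of u' "[]"]
    equiv_word_eq by (auto elim!: equivE dest: transD)

lemma word_class_mult:
  "word_eq `` {u} \<otimes>\<^bsub>free_group\<^esub> word_eq `` {v} = word_eq `` {u @ v}"
  unfolding free_group_def monoid.simps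
proof (rule UN_equiv_class2[OF equiv_word_eq equiv_word_eq])
  show "congruent2 word_eq word_eq (\<lambda>u v. word_eq `` {u @ v})"
    by (rule congruent2I') (simp add: equiv_class_eq[OF equiv_word_eq] word_eq_append)
qed auto

lemma one_free_group: "\<one>\<^bsub>free_group\<^esub> = word_eq `` {[]}"
  by (simp add: free_group_def)

lemma word_class_in_carrier [simp]: "word_eq `` {u} \<in> carrier free_group"
  by (simp add: free_group_def quotientI)

lemma free_group_cases:
  assumes "X \<in> carrier free_group"
  obtains u where "X = word_eq `` {u}"
  using assms by (auto simp: free_group_def elim: quotientE)

lemma word_eq_inverse: "(map (\<lambda>(x, e). (x, \<not> e)) (rev u) @ u, []) \<in> word_eq"
proof (induction u)
  case Nil
  show ?case by (simp add: word_eq_def)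
next
  case (Cons l u)
  obtain x e where l: "l = (x, e)" by fastforce
  let ?i = "map (\<lambda>(x, e). (x, \<not> e)) (rev u)"
  have "cancels (?i @ (x, \<not> e) # (x, e) # u) (?i @ u)"
    using cancels.intros[of ?i x "\<not> e" u] by simp
  then have "(?i @ (x, \<not> e) # (x, e) # u, ?i @ u) \<in> word_eq"
    by (simp add: word_eq_def r_into_equivclp)
  with Cons.IH have "(?i @ (x, \<not> e) # (x, e) # u, []) \<in> word_eq"
    using equiv_word_eq by (meson equivE transD)
  then show ?case by (simp add: l)
qed

lemma group_free_group: "group (free_group :: 'a word set monoid)"
proof (rule groupI)
  fix X Y Z :: "'a word set"
  assume "X \<in> carrier free_group" "Y \<in> carrier free_group" "Z \<in> carrier free_group"
  then show "X \<otimes>\<^bsub>free_group\<^esub> Y \<otimes>\<^bsub>free_group\<^esub> Z = X \<otimes>\<^bsub>free_group\<^esub> (Y \<otimes>\<^bsub>free_group\<^esub> Z)"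
    by (elim free_group_cases) (simp add: word_class_mult)
next
  fix X :: "'a word set"
  assume "X \<in> carrier free_group"
  then obtain u where u: "X = word_eq `` {u}" by (rule free_group_cases)
  show "\<exists>Y\<in>carrier free_group. Y \<otimes>\<^bsub>free_group\<^esub> X = \<one>\<^bsub>free_group\<^esub>"
    by (rule bexI[of _ "word_eq `` {map (\<lambda>(x, e). (x, \<not> e)) (rev u)}"])
      (simp_all add: u word_class_mult one_free_group
        equiv_class_eq[OF equiv_word_eq word_eq_inverse])
qed (auto elim!: free_group_cases simp: word_class_mult one_free_group)

lemma free_gen_closed [simp]: "free_gen x \<in> carrier free_group"
  by (simp add: free_gen_def)

lemma inv_free_gen: "inv\<^bsub>free_group\<^esub> (free_gen x) = word_eq `` {[(x, False)]}"
proof (rule group.inv_equality[OF group_free_group])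
  show "word_eq `` {[(x, False)]} \<otimes>\<^bsub>free_group\<^esub> free_gen x = \<one>\<^bsub>free_group\<^esub>"
    using equiv_class_eq[OF equiv_word_eq word_eq_inverse[of "[(x, True)]"]]
    by (simp add: free_gen_def word_class_mult one_free_group)
qed simp_all

lemma generate_free_group:
  "generate free_group (range (free_gen :: 'a \<Rightarrow> _)) = carrier free_group"
proof
  show "generate free_group (range free_gen) \<subseteq> carrier free_group"
    by (rule group.generate_incl[OF group_free_group]) auto
  have "word_eq `` {u} \<in> generate free_group (range free_gen)" for u :: "'a word"
  proof (induction u)
    case Nil
    show ?case by (metis generate.one one_free_group)
  next
    case (Cons l u)
    obtain x e where l: "l = (x, e)" by fastforce
    have "word_eq `` {[l]} \<in> generate free_group (range free_gen)"
      unfolding l by (cases e) (metis free_gen_def generate.incl rangeI,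
          metis inv_free_gen generate.inv rangeI)
    from generate.eng[OF this Cons.IH] show ?case by (simp add: word_class_mult)
  qed
  then show "carrier free_group \<subseteq> generate free_group (range (free_gen :: 'a \<Rightarrow> _))"
    by (metis free_group_cases subsetI)
qed

definition eval_word :: "('b, 'c) monoid_scheme \<Rightarrow> ('a \<Rightarrow> 'b) \<Rightarrow> 'a word \<Rightarrow> 'b" where
  "eval_word G f u =
     foldr (\<lambda>(x, e) y. (if e then f x else inv\<^bsub>G\<^esub> f x) \<otimes>\<^bsub>G\<^esub> y) u \<one>\<^bsub>G\<^esub>"

lemma free_group_universal:
  assumes "group G" "range f \<subseteq> carrier G"
  obtains h where "h \<in> hom free_group G" "\<And>x. h (free_gen x) = f x"
proof -
  interpret group G by fact
  have [simp]: "f x \<in> carrier G" for x using assms(2) by auto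
  have closed [simp]: "eval_word G f u \<in> carrier G" for u
    by (induction u) (auto simp: eval_word_def)
  have app: "eval_word G f (u @ v) = eval_word G f u \<otimes>\<^bsub>G\<^esub> eval_word G f v" for u v
  proof (induction u)
    case Nil
    show ?case using closed[of v] by (simp add: eval_word_def)
  next
    case (Cons l u)
    then show ?case using closed[of u] closed[of v]
      by (cases l) (auto simp: eval_word_def m_assoc)
  qed
  have canc: "eval_word G f u = eval_word G f v" if "cancels u v" for u v
    using that
  proof cases
    case (1 u' x e v')
    have "eval_word G f [(x, e), (x, \<not> e)] = \<one>\<^bsub>G\<^esub>"
      by (simp add: eval_word_def)
    moreover have "u = u' @ [(x, e), (x, \<not> e)] @ v'" using 1 by simp
    ultimately show ?thesis using 1(2) by (simp only: app) simp
  qed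
  have resp: "eval_word G f u = eval_word G f v" if "(u, v) \<in> word_eq" for u v
  proof -
    have "equivclp cancels u v" using that by (simp add: word_eq_def)
    then show ?thesis by (induction rule: equivclp_induct) (auto dest: canc)
  qed
  define h where "h X = eval_word G f (SOME u. u \<in> X)" for X
  have h: "h (word_eq `` {u}) = eval_word G f u" for u
  proof -
    have "u \<in> word_eq `` {u}" by (simp add: word_eq_def)
    then have "(SOME v. v \<in> word_eq `` {u}) \<in> word_eq `` {u}" by (rule someI)
    then show ?thesis using resp by (auto simp: h_def)
  qed
  show ?thesis
  proof (rule that)
    show "h \<in> hom free_group G"
      by (rule homI) (auto elim!: free_group_cases simp: h word_class_mult app)
    show "h (free_gen x) = f x" for x
      by (simp add: free_gen_def h) (simp add: eval_word_def)
  qed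
qed

subsection \<open>Presented groups\<close>

lemma (in group) normal_closure_normal:
  assumes "R \<subseteq> carrier G"
  shows "normal_closure G R \<lhd> G"
proof (rule normal_invI)
  have "carrier G \<lhd> G" by (rule normal_invI[OF subgroup_self]) simp
  then show "subgroup (normal_closure G R) G"
    unfolding normal_closure_def using assms
    by (intro subgroups_Inter) (auto simp: normal_imp_subgroup)
  show "x \<otimes> h \<otimes> inv x \<in> normal_closure G R"
    if "h \<in> normal_closure G R" "x \<in> carrier G" for x h
    using that by (auto simp: normal_closure_def intro: normal.inv_op_closed2)
qed

lemma normal_closure_subset: "R \<subseteq> normal_closure G R"
  by (auto simp: normal_closure_def)

lemma normal_closure_minimal: "N \<lhd> G \<Longrightarrow> R \<subseteq> N \<Longrightarrow> normal_closure G R \<subseteq> N"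
  by (auto simp: normal_closure_def)

lemma group_presented_group: "R \<subseteq> carrier free_group \<Longrightarrow> group (presented_group R)"
  unfolding presented_group_def
  by (intro normal.factorgroup_is_group group.normal_closure_normal group_free_group)

lemma presented_gen_closed [simp]: "presented_gen R x \<in> carrier (presented_group R)"
  by (auto simp: presented_gen_def presented_group_def carrier_FactGroup)

lemma generate_presented_group:
  assumes "R \<subseteq> carrier free_group"
  shows "generate (presented_group R) (range (presented_gen R)) = carrier (presented_group R)"
proof -
  let ?N = "normal_closure free_group R"
  interpret N: normal ?N free_group
    by (rule group.normal_closure_normal[OF group_free_group assms])
  have "group_hom free_group (presented_group R) (\<lambda>X. ?N #>\<^bsub>free_group\<^esub> X)"
    using group_presented_group[OF assms] N.r_coset_hom_Mod group_free_group
    by (simp add: group_hom_def group_hom_axioms_def presented_group_def)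
  from group_hom.generate_img[OF this, of "range free_gen"]
  have "(\<lambda>X. ?N #>\<^bsub>free_group\<^esub> X) ` carrier free_group =
      generate (presented_group R) (range (presented_gen R))"
    by (simp add: generate_free_group image_image image_subset_iff flip: presented_gen_def)
  then show ?thesis by (simp add: presented_group_def carrier_FactGroup)
qed

lemma presented_group_universal:
  assumes "group G" "h \<in> hom free_group G" "R \<subseteq> carrier free_group"
    and "\<And>r. r \<in> R \<Longrightarrow> h r = \<one>\<^bsub>G\<^esub>"
  obtains k where "k \<in> hom (presented_group R) G" "\<And>x. k (presented_gen R x) = h (free_gen x)"
proof -
  let ?N = "normal_closure free_group R"
  interpret h: group_hom free_group G h
    using assms group_free_group by (simp add: group_hom_def group_hom_axioms_def)
  have "?N \<subseteq> kernel free_group G h"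
    using assms by (intro normal_closure_minimal h.normal_kernel) (auto simp: kernel_def)
  moreover have "?N \<lhd> free_group"
    by (rule group.normal_closure_normal[OF group_free_group assms(3)])
  ultimately obtain k where "k \<in> hom (free_group Mod ?N) G"
    "\<And>X. X \<in> carrier free_group \<Longrightarrow> k (?N #>\<^bsub>free_group\<^esub> X) = h X"
    using h.FactGroup_universal_kernel by metis
  then show ?thesis using that by (simp add: presented_group_def presented_gen_def)
qed

subsection \<open>The Heisenberg group\<close>

lemma (in group) commutator_closed [simp]:
  "x \<in> carrier G \<Longrightarrow> y \<in> carrier G \<Longrightarrow> commutator G x y \<in> carrier G"
  by (simp add: commutator_def)

lemma heis_relators_closed: "heis_relators \<subseteq> carrier free_group"
  by (simp add: heis_relators_def Let_def group.commutator_closed[OF group_free_group])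

lemma group_heisenberg: "group heisenberg"
  unfolding heisenberg_def by (rule group_presented_group[OF heis_relators_closed])

lemma heis_gens_closed: "{heis_a, heis_b} \<subseteq> carrier heisenberg"
  by (simp add: heis_a_def heis_b_def heisenberg_def)

lemma generate_heisenberg: "generate heisenberg {heis_a, heis_b} = carrier heisenberg"
proof -
  have "(UNIV :: heis_letter set) = {Letter_a, Letter_b}"
    by (auto intro: heis_letter.exhaust)
  then have "range (presented_gen heis_relators) = presented_gen heis_relators ` {Letter_a, Letter_b}"
    by (rule arg_cong)
  then have "range (presented_gen heis_relators) = {heis_a, heis_b}"
    by (simp only: heis_a_def heis_b_def image_insert image_empty)
  then show ?thesis
    using generate_presented_group[OF heis_relators_closed] by (simp add: heisenberg_def)
qed

lemma heisenberg_exponent_sum: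
  obtains k where "k \<in> hom heisenberg integer_group" "k heis_a = 1" "k heis_b = 0"
proof -
  obtain h :: "heis_letter word set \<Rightarrow> int"
    where h: "h \<in> hom free_group integer_group" "\<And>x. h (free_gen x) = (if x = Letter_a then 1 else 0)"
    using free_group_universal[OF group_integer_group, of "\<lambda>x. if x = Letter_a then 1 else 0"] by auto
  interpret h: group_hom free_group integer_group h
    using h(1) group_free_group by (simp add: group_hom_def group_hom_axioms_def)
  have comm: "h (commutator free_group X Y) = 0"
    if "X \<in> carrier free_group" "Y \<in> carrier free_group" for X Y
    using that by (simp add: commutator_def)
  have "h r = \<one>\<^bsub>integer_group\<^esub>" if "r \<in> heis_relators" for r
    using that by (auto simp: heis_relators_def Let_def intro!: comm
        group.commutator_closed[OF group_free_group])
  from presented_group_universal[OF group_integer_group h(1) heis_relators_closed this]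
  show ?thesis using that h(2) unfolding heisenberg_def heis_a_def heis_b_def
    by (metis heis_letter.distinct(1))
qed

lemma heis_a_neq_heis_b: "heis_a \<noteq> heis_b"
  by (metis heisenberg_exponent_sum zero_neq_one)

lemma card_heis_gens: "card {heis_a, heis_b} = 2"
  by (simp add: heis_a_neq_heis_b)

lemma infinite_heisenberg: "infinite (carrier heisenberg)"
proof
  assume fin: "finite (carrier heisenberg)"
  obtain k where k: "k \<in> hom heisenberg integer_group" "k heis_a = 1"
    using heisenberg_exponent_sum by metis
  interpret k: group_hom heisenberg integer_group k
    using k(1) group_heisenberg by (simp add: group_hom_def group_hom_axioms_def)
  have "k (heis_a [^]\<^bsub>heisenberg\<^esub> n) = int n" for n :: nat
    using heis_gens_closed by (induction n) (simp_all add: k(2))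
  then have "range int \<subseteq> k ` carrier heisenberg"
    using heis_gens_closed by (auto simp: image_iff) (metis k.G.nat_pow_closed)
  with fin have "finite (range int)" by (meson finite_imageI finite_subset)
  then show False by (simp add: finite_image_iff)
qed

subsection \<open>Finiteness of lengths and depths\<close>

lemma (in group) word_length_finite:
  assumes "A \<subseteq> carrier G" "g \<in> generate G A"
  shows "word_length G A g < \<infinity>"
proof -
  have prod: "foldr (\<otimes>) (us @ vs) \<one> = foldr (\<otimes>) us \<one> \<otimes> foldr (\<otimes>) vs \<one>"
    "foldr (\<otimes>) us \<one> \<in> carrier G"
    if "set us \<subseteq> A \<union> m_inv G ` A" "set vs \<subseteq> A \<union> m_inv G ` A" for us vs
  proof -
    have c: "foldr (\<otimes>) ws \<one> \<in> carrier G" if "set ws \<subseteq> A \<union> m_inv G ` A" for ws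
      using that assms(1) by (induction ws) auto
    show "foldr (\<otimes>) us \<one> \<in> carrier G" using c that(1) .
    show "foldr (\<otimes>) (us @ vs) \<one> = foldr (\<otimes>) us \<one> \<otimes> foldr (\<otimes>) vs \<one>"
      using that(1)
    proof (induction us)
      case (Cons u us)
      then have "u \<in> carrier G" using assms(1) by auto
      with Cons show ?case using c[of us] c[OF that(2)] by (simp add: m_assoc)
    qed (use c[OF that(2)] in simp)
  qed
  have "\<exists>ws. set ws \<subseteq> A \<union> m_inv G ` A \<and> foldr (\<otimes>) ws \<one> = g"
    using assms(2)
  proof (induction rule: generate.induct)
    case one
    show ?case by (rule exI[of _ "[]"]) simp
  next
    case (incl h)
    then show ?case using assms(1) by (intro exI[of _ "[h]"]) auto
  next
    case (inv h)
    then show ?case using assms(1) by (intro exI[of _ "[inv h]"]) auto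
  next
    case (eng h1 h2)
    then obtain us vs where
      "set us \<subseteq> A \<union> m_inv G ` A" "foldr (\<otimes>) us \<one> = h1"
      "set vs \<subseteq> A \<union> m_inv G ` A" "foldr (\<otimes>) vs \<one> = h2" by blast
    then show ?case using prod(1)[of us vs] by (intro exI[of _ "us @ vs"]) auto
  qed
  then obtain ws where "set ws \<subseteq> A \<union> m_inv G ` A" "foldr (\<otimes>) ws \<one> = g" by blast
  then have "word_length G A g \<le> enat (length ws)"
    unfolding word_length_def by (intro INF_lower) simp
  also have "\<dots> < \<infinity>" by simp
  finally show ?thesis .
qed

lemma (in group) finite_word_cball:
  assumes "finite A" "r < \<infinity>"
  shows "finite (word_cball G A r)"
proof -
  obtain n where n: "r = enat n" using assms(2) by auto
  let ?W = "{ws. set ws \<subseteq> A \<union> m_inv G ` A \<and> length ws \<le> n}"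
  have "word_cball G A r \<subseteq> (\<lambda>ws. foldr (\<otimes>) ws \<one>) ` ?W"
  proof
    fix h assume "h \<in> word_cball G A r"
    then have h: "h \<in> carrier G" "word_length G A h \<le> enat n"
      by (auto simp: word_cball_def word_dist_def n)
    let ?S = "{ws. set ws \<subseteq> A \<union> m_inv G ` A \<and> foldr (\<otimes>) ws \<one> = h}"
    have "word_length G A h < enat (Suc n)" using h(2) by (simp add: le_less_trans)
    then obtain ws where "ws \<in> ?S" "enat (length ws) < enat (Suc n)"
      unfolding word_length_def INF_less_iff by blast
    then show "h \<in> (\<lambda>ws. foldr (\<otimes>) ws \<one>) ` ?W" by auto
  qed
  moreover have "finite ?W" using assms(1) by (intro finite_lists_length_le) simp
  ultimately show ?thesis by (meson finite_imageI finite_subset)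
qed

lemma (in group) element_depth_finite:
  assumes "infinite (carrier G)" "finite A" "A \<subseteq> carrier G" "generate G A = carrier G"
    and "g \<in> carrier G"
  shows "element_depth G A g < \<infinity>"
proof -
  have fin: "word_dist G A x y < \<infinity>" if "x \<in> carrier G" "y \<in> carrier G" for x y
    unfolding word_dist_def using that assms by (intro word_length_finite) auto
  have "finite (word_cball G A (word_dist G A \<one> g))"
    using assms fin by (intro finite_word_cball) auto
  then obtain h where "h \<in> carrier G - word_cball G A (word_dist G A \<one> g)"
    using assms(1) by (metis Diff_eq_empty_iff ex_in_conv finite_subset)
  then show ?thesis
    unfolding element_depth_def INF_less_iff using fin assms(5) by blast
qed

end

theory Submission
  imports Defs
begin

text \<open>
  Write \<open>c = [a, b]\<close>.  Every element of the Heisenberg group is \<open>b\<^sup>y a\<^sup>x c\<^sup>z\<close> for a unique triple of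
  integers, and a word in \<open>a, b\<close> traces a lattice path in the plane: \<open>(x, y)\<close> is its endpoint and
  \<open>z\<close> is the integral of \<open>x dy\<close> along it.  For closed paths \<open>z\<close> is the enclosed area, so the length
  of the central element \<open>c\<^sup>z\<close> is an isoperimetric quantity: a path that encloses an area larger
  than \<open>m (m - 1)\<close> has length at least \<open>4 m\<close> (\<open>length_central_ge\<close>).

  Fix \<open>n\<close>, let \<open>m = 4 n\<^sup>2 + 1\<close>, and let \<open>g = c\<^sup>k\<close> with \<open>k = m\<^sup>2 - 2 n\<^sup>2\<close>.  Then
  \<open>k > m (m - 1)\<close>, so \<open>g\<close> has length at least \<open>4 m\<close>.  An element at distance at most \<open>n\<close> from \<open>g\<close>
  is a triple \<open>(x, y, k + z)\<close> with \<open>\<bar>x\<bar> + \<bar>y\<bar> \<le> n\<close> and \<open>\<bar>z\<bar> \<le> n\<^sup>2\<close>, and a path for it of length at most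
  \<open>4 m\<close> exists: run around a square of side \<open>m\<close> whose area slightly exceeds what is needed, cut a
  thin notch out of one corner to correct the area without changing the length, and leave out the
  stretch between \<open>(x, y)\<close> and the origin, which only shortens the path
  (\<open>length_square_minus_notch_le\<close>).  So no element within distance \<open>n\<close> of \<open>g\<close> is longer than \<open>g\<close>,
  and the depth of \<open>g\<close> exceeds \<open>n\<close>.

  The argument takes place in the group of integer triples.  It is carried over to the presented
  group by an isomorphism that matches the generators (\<open>int_heis_iso_heisenberg\<close>), since depth
  depends only on the isomorphism type of a group with marked generators (\<open>group_depth_iso\<close>).
\<close>

section \<open>Word length\<close>

lemma word_length_le_iff:
  "word_length G A g \<le> enat n \<longleftrightarrow>
     (\<exists>ws. set ws \<subseteq> A \<union> m_inv G ` A \<and> foldr (mult G) ws \<one>\<^bsub>G\<^esub> = g \<and> length ws \<le> n)"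
proof -
  have "word_length G A g \<le> enat n \<longleftrightarrow> word_length G A g < enat (Suc n)"
    by (cases "word_length G A g") auto
  also have "\<dots> \<longleftrightarrow> (\<exists>ws. set ws \<subseteq> A \<union> m_inv G ` A \<and> foldr (mult G) ws \<one>\<^bsub>G\<^esub> = g \<and> length ws \<le> n)"
    by (auto simp: word_length_def INF_less_iff less_Suc_eq_le)
  finally show ?thesis .
qed

lemma (in group) foldr_mult_closed:
  "set ws \<subseteq> carrier G \<Longrightarrow> foldr (\<otimes>) ws \<one> \<in> carrier G"
  by (induction ws) auto

lemma (in group) foldr_mult_append:
  "set us \<subseteq> carrier G \<Longrightarrow> set vs \<subseteq> carrier G \<Longrightarrow>
     foldr (\<otimes>) (us @ vs) \<one> = foldr (\<otimes>) us \<one> \<otimes> foldr (\<otimes>) vs \<one>"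
  by (induction us) (auto simp: foldr_mult_closed m_assoc simp del: foldr_append simp flip: foldr_append)

lemma (in group) word_length_mult_le:
  assumes "A \<subseteq> carrier G" "word_length G A g \<le> enat p" "word_length G A h \<le> enat q"
  shows "word_length G A (g \<otimes> h) \<le> enat (p + q)"
proof -
  obtain us where us: "set us \<subseteq> A \<union> m_inv G ` A" "foldr (\<otimes>) us \<one> = g" "length us \<le> p"
    using assms(2) unfolding word_length_le_iff by blast
  obtain vs where vs: "set vs \<subseteq> A \<union> m_inv G ` A" "foldr (\<otimes>) vs \<one> = h" "length vs \<le> q"
    using assms(3) unfolding word_length_le_iff by blast
  have "A \<union> m_inv G ` A \<subseteq> carrier G" using assms(1) by auto
  then have "foldr (\<otimes>) (us @ vs) \<one> = g \<otimes> h"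
    using us vs by (subst foldr_mult_append) auto
  then show ?thesis unfolding word_length_le_iff
    using us vs by (intro exI[of _ "us @ vs"]) auto
qed

lemma (in group) word_length_int_pow_le:
  assumes "A \<subseteq> carrier G" "a \<in> A"
  shows "word_length G A (a [^] (i::int)) \<le> enat (nat \<bar>i\<bar>)"
proof -
  have a: "a \<in> carrier G" using assms by auto
  have rep: "foldr (\<otimes>) (replicate n x) \<one> = x [^] n" if "x \<in> carrier G" for x and n :: nat
  proof (induction n)
    case (Suc n)
    have "foldr (\<otimes>) (replicate (Suc n) x) \<one> = x \<otimes> x [^] n" using Suc by simp
    also have "\<dots> = x [^] Suc n" using that by (rule nat_pow_Suc2[symmetric])
    finally show ?case .
  qed simp
  define x where "x = (if i \<ge> 0 then a else inv a)"
  have "foldr (\<otimes>) (replicate (nat \<bar>i\<bar>) x) \<one> = a [^] i"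
  proof (cases i rule: int_cases2)
    case (nonneg n)
    then show ?thesis using rep[OF a] by (simp add: x_def int_pow_int)
  next
    case (nonpos n)
    then show ?thesis using a rep[of a] rep[of "inv a"]
      by (cases "n = 0") (simp_all add: x_def int_pow_neg_int nat_pow_inv)
  qed
  moreover have "set (replicate (nat \<bar>i\<bar>) x) \<subseteq> A \<union> m_inv G ` A"
    using assms(2) by (auto simp: x_def)
  ultimately show ?thesis unfolding word_length_le_iff
    by (intro exI[of _ "replicate (nat \<bar>i\<bar>) x"]) auto
qed

section \<open>Depth is an isomorphism invariant\<close>

text \<open>
  A homomorphism maps words letter by letter.  Applied to an isomorphism and to its inverse, this
  gives the equality of lengths on which the next lemma rests.
\<close>

lemma (in group_hom) word_length_hom_le:
  assumes "A \<subseteq> carrier G"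
  shows "word_length H (h ` A) (h g) \<le> word_length G A g"
proof (cases "word_length G A g")
  case (enat n)
  then obtain ws where ws: "set ws \<subseteq> A \<union> m_inv G ` A" "foldr (mult G) ws \<one>\<^bsub>G\<^esub> = g" "length ws \<le> n"
    using word_length_le_iff[of G A g n] by auto
  have sub: "A \<union> m_inv G ` A \<subseteq> carrier G" using assms by auto
  have "foldr (mult H) (map h us) \<one>\<^bsub>H\<^esub> = h (foldr (mult G) us \<one>\<^bsub>G\<^esub>)" if "set us \<subseteq> carrier G" for us
    using that by (induction us) (auto simp: G.foldr_mult_closed)
  then have "foldr (mult H) (map h ws) \<one>\<^bsub>H\<^esub> = h g" using ws sub by auto
  moreover have "h ` (A \<union> m_inv G ` A) = h ` A \<union> m_inv H ` h ` A"
    using assms by (auto simp: image_Un image_image subset_iff intro!: image_eqI)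
  then have "set (map h ws) \<subseteq> h ` A \<union> m_inv H ` h ` A"
    using image_mono[OF ws(1), of h] by (simp only: set_map)
  ultimately show ?thesis unfolding enat word_length_le_iff
    using ws(3) by (intro exI[of _ "map h ws"]) auto
qed simp

lemma group_depth_iso:
  assumes "group G" "group H" "f \<in> iso G H" "A \<subseteq> carrier G"
  shows "group_depth H (f ` A) = group_depth G A"
proof -
  interpret f: group_hom G H f
    using assms iso_imp_homomorphism by (auto simp: group_hom_def group_hom_axioms_def)
  define k where "k = inv_into (carrier G) f"
  have bij: "bij_betw f (carrier G) (carrier H)" using assms(3) by (simp add: iso_def)
  interpret k: group_hom H G k
    using assms f.G.iso_set_sym[OF assms(3)] iso_imp_homomorphism
    by (auto simp: group_hom_def group_hom_axioms_def k_def)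
  have kf: "k (f x) = x" if "x \<in> carrier G" for x
    using bij that by (simp add: k_def bij_betw_inv_into_left)
  have "k ` f ` A = (\<lambda>x. x) ` A"
    unfolding image_image using kf assms(4) by (intro image_cong) auto
  then have kA: "k ` f ` A = A" by simp
  have len: "word_length H (f ` A) (f g) = word_length G A g" if "g \<in> carrier G" for g
  proof (rule antisym)
    have "word_length G (k ` f ` A) (k (f g)) \<le> word_length H (f ` A) (f g)"
      using assms(4) by (intro k.word_length_hom_le) auto
    then show "word_length G A g \<le> word_length H (f ` A) (f g)" using kA kf that by simp
  qed (rule f.word_length_hom_le[OF assms(4)])
  have dist: "word_dist H (f ` A) (f g) (f h) = word_dist G A g h"
    if "g \<in> carrier G" "h \<in> carrier G" for g h
    using that len[of "inv\<^bsub>G\<^esub> g \<otimes>\<^bsub>G\<^esub> h"] by (simp add: word_dist_def)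
  have img: "carrier H = f ` carrier G" using bij by (simp add: bij_betw_def)
  have depth: "element_depth H (f ` A) (f g) = element_depth G A g" if g: "g \<in> carrier G" for g
  proof -
    have "word_dist H (f ` A) \<one>\<^bsub>H\<^esub> (f h) = word_dist G A \<one>\<^bsub>G\<^esub> h" if "h \<in> carrier G" for h
      using dist[of "\<one>\<^bsub>G\<^esub>" h] that by simp
    then have "word_cball H (f ` A) (word_dist H (f ` A) \<one>\<^bsub>H\<^esub> (f g)) =
        f ` word_cball G A (word_dist G A \<one>\<^bsub>G\<^esub> g)"
      using g by (auto simp: word_cball_def img)
    moreover have "inj_on f (carrier G)" using bij by (simp add: bij_betw_def)
    then have "f ` (carrier G - B) = carrier H - f ` B" if "B \<subseteq> carrier G" for B
      using that by (subst inj_on_image_set_diff[of f "carrier G"]) (auto simp: img)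
    ultimately have "carrier H - word_cball H (f ` A) (word_dist H (f ` A) \<one>\<^bsub>H\<^esub> (f g)) =
        f ` (carrier G - word_cball G A (word_dist G A \<one>\<^bsub>G\<^esub> g))"
      by (simp add: word_cball_def)
    then show ?thesis using dist g by (simp add: element_depth_def image_image)
  qed
  show ?thesis unfolding group_depth_def img using depth by (simp add: image_image)
qed

section \<open>The Heisenberg group as a group of integer triples\<close>

text \<open>
  The triple \<open>(x, y, z)\<close> stands for \<open>b\<^sup>y a\<^sup>x c\<^sup>z\<close>.  Moving \<open>b\<^bsup>y'\<^esup>\<close> to the left past \<open>a\<^sup>x\<close> creates
  \<open>c\<^bsup>x y'\<^esup>\<close>, which is the cocycle in the multiplication.  With this order of \<open>a\<close> and \<open>b\<close> the last
  coordinate of a word is the integral of \<open>x dy\<close> along its path.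
\<close>

definition int_heis :: "(int \<times> int \<times> int) monoid" where
  "int_heis = \<lparr>carrier = UNIV,
     mult = (\<lambda>(x, y, z) (x', y', z'). (x + x', y + y', z + z' + x * y')),
     one = (0, 0, 0)\<rparr>"

lemma int_heis_simps [simp]:
  "carrier int_heis = UNIV"
  "(x, y, z) \<otimes>\<^bsub>int_heis\<^esub> (x', y', z') = (x + x', y + y', z + z' + x * y')"
  "\<one>\<^bsub>int_heis\<^esub> = (0, 0, 0)"
  by (simp_all add: int_heis_def)

lemma group_int_heis: "group int_heis"
proof (rule groupI)
  fix g :: "int \<times> int \<times> int"
  assume "g \<in> carrier int_heis"
  obtain x y z where g: "g = (x, y, z)" by (cases g)
  show "\<exists>h\<in>carrier int_heis. h \<otimes>\<^bsub>int_heis\<^esub> g = \<one>\<^bsub>int_heis\<^esub>"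
    by (rule bexI[of _ "(- x, - y, x * y - z)"]) (auto simp: g)
qed (auto simp: algebra_simps)

interpretation int_heis: group int_heis
  by (rule group_int_heis)

lemma inv_int_heis [simp]: "inv\<^bsub>int_heis\<^esub> (x, y, z) = (- x, - y, x * y - z)"
  by (rule int_heis.inv_equality) auto

lemma int_heis_pow:
  "(x, 0, z) [^]\<^bsub>int_heis\<^esub> (i::int) = (i * x, 0, i * z)"
  "(0, y, z) [^]\<^bsub>int_heis\<^esub> (i::int) = (0, i * y, i * z)"
proof -
  have "(x, 0, z) [^]\<^bsub>int_heis\<^esub> n = (int n * x, 0, int n * z)"
    "(0, y, z) [^]\<^bsub>int_heis\<^esub> n = (0, int n * y, int n * z)" for n :: nat
    by (induction n) (auto simp: algebra_simps)
  then show "(x, 0, z) [^]\<^bsub>int_heis\<^esub> i = (i * x, 0, i * z)"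
    "(0, y, z) [^]\<^bsub>int_heis\<^esub> i = (0, i * y, i * z)"
    by (cases i rule: int_cases2; simp add: int_pow_int int_heis.int_pow_neg_int)+
qed

text \<open>
  The intertwining relation \<open>x v = v y\<close> says that conjugation by \<open>v\<close>, which is an automorphism, takes
  one of \<open>x, y\<close> to the other, so it passes to powers.
\<close>

lemma (in group) int_pow_semiconj:
  assumes "x \<in> carrier G" "y \<in> carrier G" "v \<in> carrier G" "x \<otimes> v = v \<otimes> y"
  shows "x [^] (i::int) \<otimes> v = v \<otimes> y [^] i"
proof -
  have nat: "x [^] n \<otimes> v = v \<otimes> y [^] n" for n :: nat
  proof (induction n)
    case (Suc n)
    have "x [^] Suc n \<otimes> v = x [^] n \<otimes> v \<otimes> y"
      using assms by (simp add: m_assoc)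
    then show ?case using assms Suc by (simp add: m_assoc)
  qed (use assms in simp)
  show ?thesis
  proof (cases i rule: int_cases2)
    case (nonneg n)
    then show ?thesis using nat[of n] by (simp add: int_pow_int)
  next
    case (nonpos n)
    have "inv (x [^] n) \<otimes> v = inv (x [^] n) \<otimes> (v \<otimes> y [^] n) \<otimes> inv (y [^] n)"
      using assms(1-3) by (simp add: m_assoc)
    also have "\<dots> = inv (x [^] n) \<otimes> (x [^] n \<otimes> v) \<otimes> inv (y [^] n)"
      by (simp only: nat)
    also have "\<dots> = v \<otimes> inv (y [^] n)"
      using assms(1-3) by (simp flip: m_assoc)
    finally show ?thesis using nonpos assms(1,2) by (simp add: int_pow_neg_int)
  qed
qed

text \<open>
  The semiconjugation lemma is used twice: \<open>a b = b (a c)\<close> gives \<open>a\<^sup>i b = b a\<^sup>i c\<^sup>i\<close> because \<open>c\<close> commutes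
  with \<open>a\<close>, and this, read as \<open>b a\<^sup>i = a\<^sup>i (b c\<^bsup>-i\<^esup>)\<close>, can be raised to the power \<open>j\<close> because \<open>c\<close>
  commutes with \<open>b\<close>.
\<close>

lemma (in group) int_pow_swap:
  assumes [simp]: "a \<in> carrier G" "b \<in> carrier G" "c \<in> carrier G"
    and ac: "a \<otimes> c = c \<otimes> a" and bc: "b \<otimes> c = c \<otimes> b" and ab: "a \<otimes> b = b \<otimes> a \<otimes> c"
  shows "a [^] (i::int) \<otimes> b [^] (j::int) = b [^] j \<otimes> a [^] i \<otimes> c [^] (i * j)"
proof -
  have cpow: "c [^] k \<otimes> x = x \<otimes> c [^] k" if "x \<in> carrier G" "x \<otimes> c = c \<otimes> x" for x and k :: int
    using int_pow_semiconj[of c c x k] that by simp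
  have 1: "a [^] i \<otimes> b = b \<otimes> (a [^] i \<otimes> c [^] i)"
  proof -
    have "a [^] i \<otimes> b = b \<otimes> (a \<otimes> c) [^] i"
      using ab by (intro int_pow_semiconj) (auto simp: m_assoc)
    then show ?thesis by (simp add: int_pow_mult_distrib[OF ac])
  qed
  have 2: "b \<otimes> a [^] i = a [^] i \<otimes> (b \<otimes> c [^] (- i))"
  proof -
    have "a [^] i \<otimes> (b \<otimes> c [^] (- i)) = b \<otimes> a [^] i \<otimes> (c [^] i \<otimes> c [^] (- i))"
      by (simp add: 1 m_assoc flip: m_assoc[of "a [^] i" b])
    also have "\<dots> = b \<otimes> a [^] i" by (simp flip: int_pow_mult)
    finally show ?thesis by simp
  qed
  have 3: "b [^] j \<otimes> a [^] i = a [^] i \<otimes> (b [^] j \<otimes> c [^] (- i * j))"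
  proof -
    have "b [^] j \<otimes> a [^] i = a [^] i \<otimes> (b \<otimes> c [^] (- i)) [^] j"
      using 2 by (intro int_pow_semiconj) auto
    then show ?thesis using cpow[of b "- i"] bc
      by (simp add: int_pow_mult_distrib[of b "c [^] (- i)"] int_pow_pow)
  qed
  have "b [^] j \<otimes> a [^] i \<otimes> c [^] (i * j) = a [^] i \<otimes> b [^] j \<otimes> (c [^] (- i * j) \<otimes> c [^] (i * j))"
    by (simp add: 3 m_assoc)
  also have "\<dots> = a [^] i \<otimes> b [^] j" by (simp flip: int_pow_mult)
  finally show ?thesis by simp
qed

text \<open>
  The universal property of the group of triples: the relations of the Heisenberg group suffice
  to bring words into the normal form \<open>b\<^sup>y a\<^sup>x c\<^sup>z\<close>.
\<close>

lemma (in group) int_heis_hom: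
  assumes [simp]: "a \<in> carrier G" "b \<in> carrier G" "c \<in> carrier G"
    and ac: "a \<otimes> c = c \<otimes> a" and bc: "b \<otimes> c = c \<otimes> b" and ab: "a \<otimes> b = b \<otimes> a \<otimes> c"
  shows "(\<lambda>(x, y, z). b [^] (y::int) \<otimes> a [^] (x::int) \<otimes> c [^] (z::int)) \<in> hom int_heis G"
proof -
  have cpow: "c [^] k \<otimes> (u [^] l \<otimes> v) = u [^] l \<otimes> (c [^] k \<otimes> v)"
    if "u \<in> carrier G" "u \<otimes> c = c \<otimes> u" "v \<in> carrier G" for u v and k l :: int
  proof -
    have "c [^] k \<otimes> u = u \<otimes> c [^] k" using int_pow_semiconj[of c c u k] that by simp
    then have "u [^] l \<otimes> c [^] k = c [^] k \<otimes> u [^] l"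
      using int_pow_semiconj[of u u "c [^] k" l] that by simp
    then show ?thesis using that by (simp flip: m_assoc)
  qed
  have "b [^] (y + y') \<otimes> a [^] (x + x') \<otimes> c [^] (z + z' + x * y') =
      (b [^] y \<otimes> a [^] x \<otimes> c [^] z) \<otimes> (b [^] y' \<otimes> a [^] x' \<otimes> c [^] z')" for x y z x' y' z' :: int
  proof -
    have "(b [^] y \<otimes> a [^] x \<otimes> c [^] z) \<otimes> (b [^] y' \<otimes> a [^] x' \<otimes> c [^] z') =
        b [^] y \<otimes> (a [^] x \<otimes> b [^] y') \<otimes> (a [^] x' \<otimes> (c [^] z \<otimes> c [^] z'))"
      by (simp add: m_assoc cpow[OF _ bc] cpow[OF _ ac])
    also have "\<dots> = b [^] y \<otimes> b [^] y' \<otimes> (a [^] x \<otimes> a [^] x') \<otimes> (c [^] (x * y') \<otimes> (c [^] z \<otimes> c [^] z'))"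
      unfolding int_pow_swap[OF assms, of x y'] by (simp add: m_assoc cpow[OF _ ac])
    also have "\<dots> = b [^] (y + y') \<otimes> a [^] (x + x') \<otimes> c [^] (x * y' + (z + z'))"
      by (simp add: int_pow_mult)
    finally show ?thesis by (simp add: add.commute)
  qed
  then show ?thesis by (auto intro!: homI)
qed

lemma (in group_hom) hom_commutator:
  "x \<in> carrier G \<Longrightarrow> y \<in> carrier G \<Longrightarrow> h (commutator G x y) = commutator H (h x) (h y)"
  by (simp add: commutator_def)

lemma (in group) mult_eq_commutator:
  assumes "x \<in> carrier G" "y \<in> carrier G"
  shows "x \<otimes> y = y \<otimes> x \<otimes> commutator G x y"
proof -
  have "u \<otimes> (inv u \<otimes> v) = v" if "u \<in> carrier G" "v \<in> carrier G" for u v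
    using that by (simp flip: m_assoc)
  then show ?thesis using assms by (simp add: commutator_def m_assoc)
qed

lemma heisenberg_relations:
  defines "c \<equiv> commutator heisenberg heis_a heis_b"
  shows "commutator heisenberg heis_a c = \<one>\<^bsub>heisenberg\<^esub>"
    and "commutator heisenberg heis_b c = \<one>\<^bsub>heisenberg\<^esub>"
proof -
  let ?N = "normal_closure free_group heis_relators"
  define p where "p = (\<lambda>X. ?N #>\<^bsub>free_group\<^esub> X)"
  interpret N: normal ?N free_group
    by (rule group.normal_closure_normal[OF group_free_group heis_relators_closed])
  interpret p: group_hom free_group heisenberg p
    using group_heisenberg N.r_coset_hom_Mod group_free_group
    by (simp add: group_hom_def group_hom_axioms_def presented_group_def heisenberg_def p_def)
  have p_gens: "p (free_gen Letter_a) = heis_a" "p (free_gen Letter_b) = heis_b"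
    by (simp_all add: p_def heis_a_def heis_b_def presented_gen_def)
  have p_rel: "p r = \<one>\<^bsub>heisenberg\<^esub>" if "r \<in> heis_relators" for r
    using that normal_closure_subset[of heis_relators free_group] N.rcos_const[of r]
    by (auto simp: p_def heisenberg_def presented_group_def FactGroup_def)
  have comm: "p (commutator free_group (free_gen l)
      (commutator free_group (free_gen Letter_a) (free_gen Letter_b))) =
    commutator heisenberg (p (free_gen l)) c" for l
    by (simp add: p.hom_commutator p_gens c_def)
  show "commutator heisenberg heis_a c = \<one>\<^bsub>heisenberg\<^esub>"
    using comm[of Letter_a] p_rel by (simp add: heis_relators_def Let_def p_gens)
  show "commutator heisenberg heis_b c = \<one>\<^bsub>heisenberg\<^esub>"
    using comm[of Letter_b] p_rel by (simp add: heis_relators_def Let_def p_gens)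
qed

lemma heisenberg_to_int_heis:
  obtains k where "k \<in> hom heisenberg int_heis" "k heis_a = (1, 0, 0)" "k heis_b = (0, 1, 0)"
proof -
  obtain h :: "heis_letter word set \<Rightarrow> int \<times> int \<times> int"
    where h: "h \<in> hom free_group int_heis"
      "\<And>x. h (free_gen x) = (if x = Letter_a then (1, 0, 0) else (0, 1, 0))"
    using free_group_universal[OF group_int_heis, of "\<lambda>x. if x = Letter_a then (1, 0, 0) else (0, 1, 0)"]
    by auto
  interpret h: group_hom free_group int_heis h
    using h(1) group_free_group group_int_heis by (simp add: group_hom_def group_hom_axioms_def)
  have "h r = \<one>\<^bsub>int_heis\<^esub>" if "r \<in> heis_relators" for r
    using that by (auto simp: heis_relators_def Let_def h.hom_commutator h(2) commutator_def)
  then obtain k where "k \<in> hom (presented_group heis_relators) int_heis"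
    "\<And>x. k (presented_gen heis_relators x) = h (free_gen x)"
    using presented_group_universal[OF group_int_heis h(1) heis_relators_closed] by blast
  then show ?thesis
    by (intro that[of k]) (simp_all add: heisenberg_def heis_a_def heis_b_def h(2))
qed

text \<open>
  The two universal properties provide homomorphisms in both directions that match the generators.
  The composite on triples is the identity because the normal form \<open>b\<^sup>y a\<^sup>x c\<^sup>z\<close> evaluates to
  \<open>(x, y, z)\<close>; this gives injectivity, and surjectivity holds because \<open>a\<close> and \<open>b\<close> generate.
\<close>

lemma int_heis_iso_heisenberg:
  obtains f where "f \<in> iso int_heis heisenberg" "f (1, 0, 0) = heis_a" "f (0, 1, 0) = heis_b"
proof -
  interpret H: group heisenberg by (rule group_heisenberg)
  have [simp]: "heis_a \<in> carrier heisenberg" "heis_b \<in> carrier heisenberg"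
    using heis_gens_closed by auto
  define c where "c = commutator heisenberg heis_a heis_b"
  have [simp]: "c \<in> carrier heisenberg" by (simp add: c_def)
  define f where "f = (\<lambda>(x, y, z). heis_b [^]\<^bsub>heisenberg\<^esub> (y::int) \<otimes>\<^bsub>heisenberg\<^esub>
     heis_a [^]\<^bsub>heisenberg\<^esub> (x::int) \<otimes>\<^bsub>heisenberg\<^esub> c [^]\<^bsub>heisenberg\<^esub> (z::int))"
  have comm: "u \<otimes>\<^bsub>heisenberg\<^esub> c = c \<otimes>\<^bsub>heisenberg\<^esub> u" if "u \<in> {heis_a, heis_b}" for u
  proof -
    have "commutator heisenberg u c = \<one>\<^bsub>heisenberg\<^esub>"
      using that heisenberg_relations unfolding c_def by blast
    then show ?thesis using that H.mult_eq_commutator[of u c] by auto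
  qed
  have "f \<in> hom int_heis heisenberg"
    unfolding f_def using H.mult_eq_commutator[of heis_a heis_b]
    by (intro H.int_heis_hom comm) (simp_all flip: c_def)
  then interpret f: group_hom int_heis heisenberg f
    by (simp add: group_hom_def group_hom_axioms_def group_int_heis group_heisenberg)
  have gens: "f (1, 0, 0) = heis_a" "f (0, 1, 0) = heis_b" by (simp_all add: f_def)
  obtain k where k: "k \<in> hom heisenberg int_heis" "k heis_a = (1, 0, 0)" "k heis_b = (0, 1, 0)"
    by (rule heisenberg_to_int_heis)
  interpret k: group_hom heisenberg int_heis k
    by (simp add: group_hom_def group_hom_axioms_def group_int_heis group_heisenberg k)
  have kc: "k c = (0, 0, 1)"
    by (simp add: c_def k.hom_commutator k(2,3)) (simp add: commutator_def)
  have "k (f g) = g" for g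
    by (cases g) (simp add: f_def k.hom_int_pow k(2,3) kc int_heis_pow)
  then have inj: "inj f" by (rule inj_on_inverseI)
  have "generate heisenberg {heis_a, heis_b} \<subseteq> f ` carrier int_heis"
    unfolding gens[symmetric] by (intro H.generate_subgroup_incl f.img_is_subgroup) auto
  then have "f ` UNIV = carrier heisenberg" using generate_heisenberg f.hom_closed by auto
  then have "bij_betw f (carrier int_heis) (carrier heisenberg)"
    using inj by (simp add: bij_betw_def)
  then have "f \<in> iso int_heis heisenberg"
    using f.homh by (simp add: iso_def)
  then show ?thesis using gens by (rule that)
qed

section \<open>Lengths of integer triples\<close>

abbreviation heis_gens :: "(int \<times> int \<times> int) set" where
  "heis_gens \<equiv> {(1, 0, 0), (0, 1, 0)}"

text \<open>
  The suffixes of a word trace its path: a letter \<open>a\<^bsup>\<plusminus>1\<^esup>\<close> in front adds \<open>\<plusminus>y\<close> to \<open>z\<close>, where \<open>y\<close> is the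
  current height.  If all heights lie between \<open>lo\<close> and \<open>hi\<close>, and there are \<open>u\<close> letters \<open>a\<close> and \<open>d\<close>
  letters \<open>a\<^bsup>-1\<^esup>\<close>, then \<open>z \<le> u hi - d lo\<close>.  A walk from height \<open>0\<close> to height \<open>y\<close> that visits both
  extremes takes at least \<open>2 (hi - lo) - \<bar>y\<bar>\<close> vertical steps.  For a closed path \<open>u = d\<close> and \<open>y = 0\<close>,
  so the area is at most that of a rectangle whose perimeter is at most the length.
\<close>

lemma isoperimetric_word:
  assumes "set ws \<subseteq> heis_gens \<union> m_inv int_heis ` heis_gens"
    and "foldr (mult int_heis) ws \<one>\<^bsub>int_heis\<^esub> = (x, y, z)"
  shows "\<exists>lo hi u d. lo \<le> 0 \<and> 0 \<le> hi \<and> lo \<le> y \<and> y \<le> hi \<and> 0 \<le> u \<and> 0 \<le> d \<and> x = u - d \<and>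
    z \<le> u * hi - d * lo \<and> 2 * (hi - lo) - \<bar>y\<bar> + u + d \<le> int (length ws)"
  using assms
proof (induction ws arbitrary: x y z)
  case Nil
  then show ?case by (intro exI[of _ "0::int"] conjI) simp_all
next
  case (Cons l ws)
  obtain x' y' z' where w: "foldr (mult int_heis) ws \<one>\<^bsub>int_heis\<^esub> = (x', y', z')"
    by (metis prod_cases3)
  obtain lo hi u d where IH: "lo \<le> 0" "0 \<le> hi" "lo \<le> y'" "y' \<le> hi" "0 \<le> u" "0 \<le> d" "x' = u - d"
    "z' \<le> u * hi - d * lo" "2 * (hi - lo) - \<bar>y'\<bar> + u + d \<le> int (length ws)"
    using Cons.IH[OF _ w] Cons.prems(1) unfolding list.set insert_subset by blast
  have witness: ?case
    if "lo \<le> 0" "0 \<le> hi" "lo \<le> y" "y \<le> hi" "0 \<le> u" "0 \<le> d" "x = u - d"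
      "z \<le> u * hi - d * lo" "2 * (hi - lo) - \<bar>y\<bar> + u + d \<le> int (length (l # ws))" for lo hi u d
    using that by blast
  have l: "l \<in> {(1, 0, 0), (-1, 0, 0), (0, 1, 0), (0, -1, 0)}"
    using Cons.prems(1) by auto
  have eq: "l \<otimes>\<^bsub>int_heis\<^esub> (x', y', z') = (x, y, z)" using Cons.prems(2) w by simp
  from l consider "l = (1, 0, 0)" | "l = (-1, 0, 0)" | "l = (0, 1, 0)" | "l = (0, -1, 0)" by auto
  then show ?case
  proof cases
    case 1
    then have "x = x' + 1" "y = y'" "z = z' + y'" using eq by auto
    then show ?thesis using IH
      by (intro witness[of lo hi "u + 1" d]) (auto simp: algebra_simps)
  next
    case 2
    then have "x = x' - 1" "y = y'" "z = z' - y'" using eq by auto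
    then show ?thesis using IH
      by (intro witness[of lo hi u "d + 1"]) (auto simp: algebra_simps)
  next
    case 3
    then have e: "x = x'" "y = y' + 1" "z = z'" using eq by auto
    have "u * hi \<le> u * max hi y" using IH by (intro mult_left_mono) auto
    then have "z \<le> u * max hi y - d * lo" using IH(8) e by linarith
    moreover have "2 * (max hi y - lo) - \<bar>y\<bar> + u + d \<le> int (length (l # ws))"
      using IH(1-4,9) e by (simp add: max_def abs_if split: if_splits)
    ultimately show ?thesis using IH(1-7) e
      by (intro witness[of lo "max hi y" u d]) auto
  next
    case 4
    then have e: "x = x'" "y = y' - 1" "z = z'" using eq by auto
    have "d * min lo y \<le> d * lo" using IH by (intro mult_left_mono) auto
    then have "z \<le> u * hi - d * min lo y" using IH(8) e by linarith
    moreover have "2 * (hi - min lo y) - \<bar>y\<bar> + u + d \<le> int (length (l # ws))"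
      using IH(1-4,9) e by (simp add: min_def abs_if split: if_splits)
    ultimately show ?thesis using IH(1-7) e
      by (intro witness[of "min lo y" hi u d]) auto
  qed
qed

text \<open>
  A word shorter than \<open>4 m\<close> would enclose at most the area of a \<open>u\<close> by \<open>p\<close> rectangle with
  \<open>2 u + 2 p < 4 m\<close>, hence \<open>u + p \<le> 2 m - 1\<close>, and under this constraint the integer product \<open>u p\<close> is at
  most \<open>m (m - 1)\<close>.
\<close>

lemma length_central_ge:
  assumes "z > int m * (int m - 1)"
  shows "word_length int_heis heis_gens (0, 0, z) \<ge> enat (4 * m)"
proof (rule ccontr)
  assume neg: "\<not> ?thesis"
  then have m: "m > 0" by (cases m) (auto simp: zero_enat_def[symmetric])
  have "word_length int_heis heis_gens (0, 0, z) \<le> enat (4 * m - 1)"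
    using neg m by (cases "word_length int_heis heis_gens (0, 0, z)") auto
  then obtain ws where ws: "set ws \<subseteq> heis_gens \<union> m_inv int_heis ` heis_gens"
    "foldr (mult int_heis) ws \<one>\<^bsub>int_heis\<^esub> = (0, 0, z)" "length ws \<le> 4 * m - 1"
    unfolding word_length_le_iff by blast
  from isoperimetric_word[OF ws(1,2)] obtain lo hi u d where h: "lo \<le> 0" "0 \<le> hi" "0 \<le> u"
    "(0::int) = u - d" "z \<le> u * hi - d * lo" "2 * (hi - lo) - \<bar>0\<bar> + u + d \<le> int (length ws)" by blast
  define p where "p = hi - lo"
  have z: "z \<le> u * p" using h by (simp add: p_def algebra_simps)
  have up: "u + p \<le> 2 * int m - 1" using h ws(3) m by (simp add: p_def)
  \<comment> \<open>Bounding \<open>p\<close> in terms of \<open>u\<close> leaves a quadratic in \<open>u\<close> that takes its maximum over the integers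
    at \<open>m\<close> and at \<open>m - 1\<close>.\<close>
  have "u * p \<le> u * (2 * int m - 1 - u)" using up h by (intro mult_left_mono) auto
  moreover have "0 \<le> (u - int m) * (u - (int m - 1))"
    by (cases "u \<ge> int m") (auto intro: mult_nonneg_nonneg mult_nonpos_nonpos)
  ultimately have "u * p \<le> int m * (int m - 1)" by (simp add: algebra_simps)
  with z assms show False by simp
qed

lemma word_displacement:
  assumes "set ws \<subseteq> heis_gens \<union> m_inv int_heis ` heis_gens"
    and "foldr (mult int_heis) ws \<one>\<^bsub>int_heis\<^esub> = (x, y, z)"
  shows "\<bar>x\<bar> + \<bar>y\<bar> \<le> int (length ws)" "\<bar>z\<bar> \<le> int (length ws) ^ 2"
proof -
  have "\<bar>x\<bar> + \<bar>y\<bar> \<le> int (length ws) \<and> \<bar>z\<bar> \<le> int (length ws) ^ 2"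
    using assms
  proof (induction ws arbitrary: x y z)
    case (Cons l ws)
    obtain x' y' z' where w: "foldr (mult int_heis) ws \<one>\<^bsub>int_heis\<^esub> = (x', y', z')"
      by (metis prod_cases3)
    have IH: "\<bar>x'\<bar> + \<bar>y'\<bar> \<le> int (length ws)" "\<bar>z'\<bar> \<le> int (length ws) ^ 2"
      using Cons.IH[OF _ w] Cons.prems(1) by auto
    have "int (length (l # ws)) ^ 2 = int (length ws) ^ 2 + 2 * int (length ws) + 1"
      by (simp add: power2_eq_square algebra_simps)
    moreover have "l \<otimes>\<^bsub>int_heis\<^esub> (x', y', z') = (x, y, z)" using Cons.prems(2) w by simp
    moreover have "l \<in> {(1, 0, 0), (-1, 0, 0), (0, 1, 0), (0, -1, 0)}"
      using Cons.prems(1) by auto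
    ultimately show ?case using IH by auto
  qed auto
  then show "\<bar>x\<bar> + \<bar>y\<bar> \<le> int (length ws)" "\<bar>z\<bar> \<le> int (length ws) ^ 2" by auto
qed

text \<open>
  The word is \<open>b\<^bsup>j0\<^esup> a\<^bsup>i1\<^esup> b\<^bsup>j1\<^esup> a\<^bsup>i2\<^esup> b\<^bsup>j2\<^esup> a\<^bsup>i3\<^esup> b\<^bsup>j3\<^esup>\<close>.  Seven blocks suffice for a square with a notch,
  whichever side the path starts on.
\<close>

lemma length_staircase_le:
  fixes i1 i2 i3 j0 j1 j2 j3 :: int
  assumes "\<bar>j0\<bar> + \<bar>i1\<bar> + \<bar>j1\<bar> + \<bar>i2\<bar> + \<bar>j2\<bar> + \<bar>i3\<bar> + \<bar>j3\<bar> \<le> int n"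
    and "x = i1 + i2 + i3" "y = j0 + j1 + j2 + j3"
    and "z = i1 * j1 + (i1 + i2) * j2 + (i1 + i2 + i3) * j3"
  shows "word_length int_heis heis_gens (x, y, z) \<le> enat n"
proof -
  have A: "word_length int_heis heis_gens (i, 0, 0) \<le> enat (nat \<bar>i\<bar>)"
    and B: "word_length int_heis heis_gens (0, i, 0) \<le> enat (nat \<bar>i\<bar>)" for i
    using int_heis.word_length_int_pow_le[of heis_gens "(1, 0, 0)" i]
      int_heis.word_length_int_pow_le[of heis_gens "(0, 1, 0)" i]
    by (auto simp: int_heis_pow)
  note M = int_heis.word_length_mult_le[of heis_gens]
  have "word_length int_heis heis_gens
      ((0, j0, 0) \<otimes>\<^bsub>int_heis\<^esub> ((i1, 0, 0) \<otimes>\<^bsub>int_heis\<^esub> ((0, j1, 0) \<otimes>\<^bsub>int_heis\<^esub> ((i2, 0, 0) \<otimes>\<^bsub>int_heis\<^esub>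
       ((0, j2, 0) \<otimes>\<^bsub>int_heis\<^esub> ((i3, 0, 0) \<otimes>\<^bsub>int_heis\<^esub> (0, j3, 0)))))))
    \<le> enat (nat \<bar>j0\<bar> + (nat \<bar>i1\<bar> + (nat \<bar>j1\<bar> + (nat \<bar>i2\<bar> + (nat \<bar>j2\<bar> + (nat \<bar>i3\<bar> + nat \<bar>j3\<bar>))))))"
    by (intro M A B) auto
  also have "\<dots> \<le> enat n"
  proof -
    have "int (nat \<bar>j0\<bar> + (nat \<bar>i1\<bar> + (nat \<bar>j1\<bar> + (nat \<bar>i2\<bar> + (nat \<bar>j2\<bar> + (nat \<bar>i3\<bar> + nat \<bar>j3\<bar>))))))
        \<le> int n" using assms(1) by simp
    then show ?thesis by (simp only: of_nat_le_iff enat_ord_simps)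
  qed
  finally show ?thesis by (simp add: assms(2-) algebra_simps)
qed

text \<open>
  The path runs counterclockwise around a square of side \<open>m\<close>, with an \<open>s\<close> by \<open>1\<close> notch in one corner.
  The origin and \<open>(x, y)\<close> lie on the two sides at the opposite corner, and the path leaves out the
  stretch of length \<open>\<bar>x\<bar> + \<bar>y\<bar>\<close> that leads around that corner back from \<open>(x, y)\<close> to the origin.  The
  orientation forces this corner to be \<open>(0, y)\<close> if \<open>x\<close> and \<open>y\<close> have the same sign and \<open>(x, 0)\<close>
  otherwise; in the second case the integral of \<open>x dy\<close> along the missing stretch is \<open>- x y\<close>, which
  explains the term \<open>x y\<close>.
\<close>

lemma length_square_minus_notch_le:
  fixes x y s :: int
  assumes m: "m \<ge> 1" and x: "\<bar>x\<bar> \<le> int m" and y: "\<bar>y\<bar> \<le> int m" and s: "0 \<le> s" "s \<le> int m"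
  shows "word_length int_heis heis_gens (x, y, int m ^ 2 + (if (x \<ge> 0) = (y \<ge> 0) then 0 else x * y) - s)
    \<le> enat (4 * m)"
proof -
  note [simp] = power2_eq_square algebra_simps
  consider "x \<ge> 0" "y \<ge> 0" | "x < 0" "y < 0" | "x < 0" "y \<ge> 0" | "x \<ge> 0" "y < 0" by linarith
  then show ?thesis
  proof cases
    case 1
    then show ?thesis using assms
      by (intro length_staircase_le[where ?j0.0 = "- (int m - y)" and ?i1.0 = "int m - 1" and ?j1.0 = s
            and ?i2.0 = 1 and ?j2.0 = "int m - s" and ?i3.0 = "- (int m - x)" and ?j3.0 = 0]) auto
  next
    case 2
    then show ?thesis using assms
      by (intro length_staircase_le[where ?j0.0 = "int m + y" and ?i1.0 = "- (int m - 1)" and ?j1.0 = "- s"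
            and ?i2.0 = "-1" and ?j2.0 = "- (int m - s)" and ?i3.0 = "int m + x" and ?j3.0 = 0]) auto
  next
    case 3
    then show ?thesis using assms
      by (intro length_staircase_le[where ?j0.0 = 0 and ?i1.0 = "int m + x" and ?j1.0 = "int m - s"
            and ?i2.0 = "-1" and ?j2.0 = s and ?i3.0 = "- (int m - 1)" and ?j3.0 = "- (int m - y)"]) auto
  next
    case 4
    then show ?thesis using assms
      by (intro length_staircase_le[where ?j0.0 = 0 and ?i1.0 = "- (int m - x)" and ?j1.0 = "- (int m - s)"
            and ?i2.0 = 1 and ?j2.0 = "- s" and ?i3.0 = "int m - 1" and ?j3.0 = "int m + y"]) auto
  qed
qed

section \<open>Deep elements\<close>

text \<open>
  The choice of \<open>k = m\<^sup>2 - 2 n\<^sup>2\<close> leaves room on both sides: passing to an element within distance \<open>n\<close>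
  changes the last coordinate by at most \<open>n\<^sup>2\<close>, and the correction \<open>x y\<close> is also at most \<open>n\<^sup>2\<close>, so the
  notch that has to be cut has size between \<open>0\<close> and \<open>4 n\<^sup>2 < m\<close>.
\<close>

lemma element_depth_int_heis_ge:
  fixes n :: nat
  defines "m \<equiv> 4 * n\<^sup>2 + 1"
  shows "element_depth int_heis heis_gens (0, 0, int m ^ 2 - 2 * int n ^ 2) \<ge> enat n"
  unfolding element_depth_def
proof (rule INF_greatest)
  define g :: "int \<times> int \<times> int" where "g = (0, 0, int m ^ 2 - 2 * int n ^ 2)"
  fix h
  assume "h \<in> carrier int_heis - word_cball int_heis heis_gens
      (word_dist int_heis heis_gens \<one>\<^bsub>int_heis\<^esub> (0, 0, int m ^ 2 - 2 * int n ^ 2))"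
  then have far: "word_length int_heis heis_gens g < word_length int_heis heis_gens h"
    by (cases h) (auto simp: word_cball_def word_dist_def g_def)
  have "2 * int n ^ 2 < int m" using zero_le_power2[of "int n"] by (simp add: m_def)
  then have "int m * (int m - 1) < int m ^ 2 - 2 * int n ^ 2"
    by (simp add: power2_eq_square[of "int m"] algebra_simps)
  then have g: "enat (4 * m) \<le> word_length int_heis heis_gens g"
    unfolding g_def by (rule length_central_ge)
  have "word_length int_heis heis_gens h \<le> enat (4 * m)"
    if "word_dist int_heis heis_gens g h \<le> enat n"
  proof -
    obtain hx hy hz where h: "h = (hx, hy, hz)" by (metis prod_cases3)
    define z where "z = hz - (int m ^ 2 - 2 * int n ^ 2)"
    have v: "inv\<^bsub>int_heis\<^esub> g \<otimes>\<^bsub>int_heis\<^esub> h = (hx, hy, z)" by (simp add: g_def h z_def)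
    obtain ws where ws: "set ws \<subseteq> heis_gens \<union> m_inv int_heis ` heis_gens"
      "foldr (mult int_heis) ws \<one>\<^bsub>int_heis\<^esub> = (hx, hy, z)" "length ws \<le> n"
      using \<open>word_dist int_heis heis_gens g h \<le> enat n\<close> unfolding word_dist_def v word_length_le_iff by blast
    have xy: "\<bar>hx\<bar> \<le> int n" "\<bar>hy\<bar> \<le> int n" and "\<bar>z\<bar> \<le> int (length ws) ^ 2"
      using word_displacement[OF ws(1,2)] ws(3) by auto
    then have z: "\<bar>z\<bar> \<le> int n ^ 2" using ws(3) power_mono[of "int (length ws)" "int n" 2] by linarith
    have prod: "\<bar>hx * hy\<bar> \<le> int n ^ 2"
      using mult_mono[OF xy] by (simp add: abs_mult power2_eq_square)
    have "n \<le> m" unfolding m_def power2_eq_square using le_square[of n] by linarith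
    define e where "e = (if (hx \<ge> 0) = (hy \<ge> 0) then 0 else hx * hy)"
    define s where "s = 2 * int n ^ 2 + e - z"
    have "\<bar>e\<bar> \<le> int n ^ 2" using prod by (simp add: e_def)
    then have "0 \<le> s" "s \<le> int m" using z by (auto simp: s_def m_def)
    then have "word_length int_heis heis_gens (hx, hy, int m ^ 2 + e - s) \<le> enat (4 * m)"
      unfolding e_def using xy \<open>n \<le> m\<close>
      by (intro length_square_minus_notch_le) (simp add: m_def, linarith+)
    then show ?thesis by (simp add: h s_def z_def)
  qed
  then have "\<not> word_dist int_heis heis_gens g h \<le> enat n"
    using far g by (meson leD order_trans)
  then show "enat n \<le> word_dist int_heis heis_gens (0, 0, int m ^ 2 - 2 * int n ^ 2) h"
    by (simp add: g_def)
qed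

theorem proposition4:
  shows "group_depth heisenberg {heis_a, heis_b} = \<infinity>"
proof -
  have ge: "enat n \<le> group_depth int_heis heis_gens" for n
  proof -
    have "enat n \<le> element_depth int_heis heis_gens (0, 0, int (4 * n\<^sup>2 + 1) ^ 2 - 2 * int n ^ 2)"
      by (rule element_depth_int_heis_ge)
    also have "\<dots> \<le> group_depth int_heis heis_gens"
      unfolding group_depth_def by (rule SUP_upper) simp
    finally show ?thesis .
  qed
  have inf: "group_depth int_heis heis_gens = \<infinity>"
  proof (cases "group_depth int_heis heis_gens")
    case (enat k)
    then show ?thesis using ge[of "Suc k"] by simp
  qed
  obtain f where f: "f \<in> iso int_heis heisenberg" "f (1, 0, 0) = heis_a" "f (0, 1, 0) = heis_b"
    by (rule int_heis_iso_heisenberg)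
  then show ?thesis
    using group_depth_iso[OF group_int_heis group_heisenberg f(1), of heis_gens] inf by simp
qed

end
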